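(* Let $\Xi\sim\mathrm{PIP}(\beta,\varphi)$ be a stationary pairwise interaction process on $\mathbb{R}^d$ that is inhibitory and has finite interaction range, and let $\lambda$ be its intensity. Put $G=\int_{\mathbb{R}^d}(1-\varphi(x))\,dx$. Then $$\frac{\beta}{1+\beta G}\;\le\;\lambda\;\le\;\frac{\beta}{2-e^{-\beta G}}.$$
   Context: Let $\mathfrak{N}$ be the space of locally finite point measures on $\mathbb{R}^d$ with the $\sigma$-algebra generated by the evaluation maps $\xi\mapsto\xi(A)$, $A$ bounded Borel. A point process is a random element of $\mathfrak{N}$; all point processes are simple, so configurations are identified with locally finite sets. A point process $\Xi$ on $\mathbb{R}^d$ is a Gibbs process with conditional intensity $\lambda(\cdot\mid\cdot)\colon\mathbb{R}^d\times\mathfrak{N}\to[0,\infty)$ (measurable) if $$\mathbb{E}\Bigl(\int_{\mathbb{R}^d} h(x,\Xi\setminus\{x\})\,\Xi(dx)\Bigr)=\int_{\mathbb{R}^d}\mathbb{E}\bigl(h(x,\Xi)\lambda(x\mid\Xi)\bigr)\,dx$$ for all measurable $h\colon\mathbb{R}^d\times\mathfrak{N}\to[0,\infty)$. $\Xi$ need not be uniquely determined by $\lambda(\cdot\mid\cdot)$; results hold for every such process. $\Xi$ is stationary if its distribution is translation invariant. $\Xi\sim\mathrm{PIP}(\beta,\varphi)$ (stationary pairwise interaction process) means that $\Xi$ is a stationary Gibbs process with conditional intensity $\lambda(x\mid\xi)=\beta\prod_{y\in\xi}\varphi(x-y)$, where $\beta>0$ is a constant and $\varphi\colon\mathbb{R}^d\to[0,\infty)$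 is a measurable interaction function with $\varphi(-x)=\varphi(x)$. It is inhibitory if $\varphi\le1$ and has finite interaction range if $1-\varphi$ is compactly supported. The intensity of $\Xi$ is the constant $\lambda=\mathbb{E}(\lambda(0\mid\Xi))$, i.e. $\mathbb{E}\,\Xi(A)=\lambda|A|$ for Borel sets $A$. *)

theory Defs
  imports "HOL-Probability.Probability"
begin

text \<open>Point processes are simple throughout, so a locally finite point measure is represented by
  its support: the mass it gives to a bounded set \<open>A\<close> is \<open>card (\<xi> \<inter> A)\<close>, and integration
  against it is integration against \<open>count_space \<xi>\<close>.\<close>

definition locally_finite_set :: "'a::euclidean_space set \<Rightarrow> bool" where
  "locally_finite_set \<xi> \<longleftrightarrow> (\<forall>A. bounded A \<longrightarrow> finite (\<xi> \<inter> A))"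

text \<open>The supremum of the vimage algebras is the \<open>\<sigma>\<close>-algebra generated by the evaluation maps
  (only its measurable space is relevant, as for \<^const>\<open>subprob_algebra\<close>).\<close>

definition configs :: "'a::euclidean_space set measure" where
  "configs = (SUP A \<in> {A \<in> sets borel. bounded A}.
     vimage_algebra {\<xi>. locally_finite_set \<xi>} (\<lambda>\<xi>. card (\<xi> \<inter> A)) (count_space UNIV))"

definition point_process :: "'w measure \<Rightarrow> ('w \<Rightarrow> 'a::euclidean_space set) \<Rightarrow> bool" where
  "point_process M \<Xi> \<longleftrightarrow> prob_space M \<and> \<Xi> \<in> M \<rightarrow>\<^sub>M configs"

definition stationary :: "'w measure \<Rightarrow> ('w \<Rightarrow> 'a::euclidean_space set) \<Rightarrow> bool" where
  "stationary M \<Xi> \<longleftrightarrow>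
     (\<forall>v. distr M configs (\<lambda>\<omega>. (\<lambda>x. x + v) ` \<Xi> \<omega>) = distr M configs \<Xi>)"

definition gibbs_process ::
  "'w measure \<Rightarrow> ('w \<Rightarrow> 'a::euclidean_space set) \<Rightarrow> ('a \<Rightarrow> 'a set \<Rightarrow> real) \<Rightarrow> bool" where
  "gibbs_process M \<Xi> L \<longleftrightarrow>
     point_process M \<Xi> \<and>
     (\<lambda>(x, \<xi>). L x \<xi>) \<in> borel_measurable (borel \<Otimes>\<^sub>M configs) \<and>
     (\<forall>x. \<forall>\<xi>\<in>space configs. 0 \<le> L x \<xi>) \<and>
     (\<forall>h :: 'a \<times> 'a set \<Rightarrow> real.
        h \<in> borel_measurable (borel \<Otimes>\<^sub>M configs) \<longrightarrow> (\<forall>p. 0 \<le> h p) \<longrightarrow>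
        (\<integral>\<^sup>+\<omega>. (\<integral>\<^sup>+x. ennreal (h (x, \<Xi> \<omega> - {x})) \<partial>count_space (\<Xi> \<omega>)) \<partial>M) =
        (\<integral>\<^sup>+x. (\<integral>\<^sup>+\<omega>. ennreal (h (x, \<Xi> \<omega>) * L x (\<Xi> \<omega>)) \<partial>M) \<partial>lborel))"

text \<open>A configuration may be infinite, and \<^const>\<open>prod\<close> is \<open>1\<close> on infinite index sets, so the
  product over \<open>\<xi>\<close> is taken as the limit along the finite subsets of \<open>\<xi>\<close>.  It always exists if
  \<open>0 \<le> \<phi> \<le> 1\<close>, and it is a finite product if \<open>\<phi>\<close> has finite range.\<close>

definition pip_cond_intensity ::
  "real \<Rightarrow> ('a::euclidean_space \<Rightarrow> real) \<Rightarrow> 'a \<Rightarrow> 'a set \<Rightarrow> real" where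
  "pip_cond_intensity \<beta> \<phi> x \<xi> =
     \<beta> * Lim (finite_subsets_at_top \<xi>) (\<lambda>F. \<Prod>y\<in>F. \<phi> (x - y))"

definition PIP ::
  "'w measure \<Rightarrow> ('w \<Rightarrow> 'a::euclidean_space set) \<Rightarrow> real \<Rightarrow> ('a \<Rightarrow> real) \<Rightarrow> bool" where
  "PIP M \<Xi> \<beta> \<phi> \<longleftrightarrow>
     0 < \<beta> \<and> \<phi> \<in> borel_measurable borel \<and> (\<forall>x. 0 \<le> \<phi> x) \<and> (\<forall>x. \<phi> (- x) = \<phi> x) \<and>
     stationary M \<Xi> \<and> gibbs_process M \<Xi> (pip_cond_intensity \<beta> \<phi>)"

definition inhibitory :: "('a \<Rightarrow> real) \<Rightarrow> bool" where
  "inhibitory \<phi> \<longleftrightarrow> (\<forall>x. \<phi> x \<le> 1)"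

definition finite_range :: "('a::euclidean_space \<Rightarrow> real) \<Rightarrow> bool" where
  "finite_range \<phi> \<longleftrightarrow> compact (closure {x. 1 - \<phi> x \<noteq> 0})"

definition intensity ::
  "'w measure \<Rightarrow> ('w \<Rightarrow> 'a::euclidean_space set) \<Rightarrow> ('a \<Rightarrow> 'a set \<Rightarrow> real) \<Rightarrow> real" where
  "intensity M \<Xi> L = (\<integral>\<omega>. L 0 (\<Xi> \<omega>) \<partial>M)"

lemma space_configs: "space configs = {\<xi> :: 'a::euclidean_space set. locally_finite_set \<xi>}"
proof -
  have "{A :: 'a set. A \<in> sets borel \<and> bounded A} \<noteq> {}" by (auto intro!: exI[of _ "{}"])
  then show ?thesis unfolding configs_def by (subst space_Sup_eq_UN) auto
qed

lemma pip_cond_intensity_finite_range: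
  fixes \<phi> :: "'a::euclidean_space \<Rightarrow> real"
  assumes "finite_range \<phi>" "\<xi> \<in> space configs"
  shows "finite {y\<in>\<xi>. \<phi> (x - y) \<noteq> 1}"
    and "pip_cond_intensity \<beta> \<phi> x \<xi> = \<beta> * (\<Prod>y\<in>{y\<in>\<xi>. \<phi> (x - y) \<noteq> 1}. \<phi> (x - y))"
proof -
  let ?S = "{y\<in>\<xi>. \<phi> (x - y) \<noteq> 1}"
  have "bounded {z. 1 - \<phi> z \<noteq> 0}"
    using assms(1) unfolding finite_range_def
    by (meson bounded_subset closure_subset compact_imp_bounded)
  then obtain B where B: "\<And>z. \<phi> z \<noteq> 1 \<Longrightarrow> norm z \<le> B"
    by (auto simp: bounded_iff)
  have "{y. \<phi> (x - y) \<noteq> 1} \<subseteq> cball x B" using B by (auto simp: dist_norm)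
  then have "bounded {y. \<phi> (x - y) \<noteq> 1}" by (rule bounded_subset[OF bounded_cball])
  then have "finite (\<xi> \<inter> {y. \<phi> (x - y) \<noteq> 1})"
    using assms(2) by (auto simp: space_configs locally_finite_set_def)
  moreover have "\<xi> \<inter> {y. \<phi> (x - y) \<noteq> 1} = ?S" by auto
  ultimately show fin: "finite ?S" by simp
  have "eventually (\<lambda>F. (\<Prod>y\<in>F. \<phi> (x - y)) = (\<Prod>y\<in>?S. \<phi> (x - y))) (finite_subsets_at_top \<xi>)"
    unfolding eventually_finite_subsets_at_top
    using fin by (intro exI[of _ ?S]) (auto intro!: prod.mono_neutral_right)
  then have "Lim (finite_subsets_at_top \<xi>) (\<lambda>F. \<Prod>y\<in>F. \<phi> (x - y)) = (\<Prod>y\<in>?S. \<phi> (x - y))"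
    by (intro tendsto_Lim tendsto_eventually) auto
  then show "pip_cond_intensity \<beta> \<phi> x \<xi> = \<beta> * (\<Prod>y\<in>?S. \<phi> (x - y))"
    by (simp add: pip_cond_intensity_def)
qed

end

theory Submission
  imports Defs
begin

text \<open>Write \<open>u = 1 - \<phi>\<close>, so that \<open>0 \<le> u \<le> 1\<close> and \<open>\<integral>u = G\<close>, and let \<open>P\<^sub>s(\<xi>)\<close> be the product of
  \<open>1 - s u(y)\<close> over the points \<open>y\<close> of \<open>\<xi>\<close>.  By symmetry of \<open>\<phi>\<close> the conditional intensity at the
  origin is \<open>L(0, \<xi>) = \<beta> P\<^sub>1(\<xi>)\<close>, hence \<open>\<lambda> = \<beta> E P\<^sub>1(\<Xi>)\<close>, and both bounds are statements about
  the drop of \<open>F(s) = E P\<^sub>s(\<Xi>)\<close> from \<open>F(0) = 1\<close> to \<open>F(1) = \<lambda>/\<beta>\<close>.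

  Formally \<open>- dP\<^sub>s(\<xi>)/ds\<close> is the sum over \<open>y \<in> \<xi>\<close> of \<open>u(y) P\<^sub>s(\<xi> - {y})\<close>, and the Georgii-Nguyen-Zessin
  equation which defines Gibbs processes turns the expectation of this sum into
  \<open>- F'(s) = \<integral> u(x) H\<^sub>x(s) dx\<close> with \<open>H\<^sub>x(s) = E(L(x, \<Xi>) P\<^sub>s(\<Xi>))\<close>.  By stationarity \<open>H\<^sub>x(0) = \<lambda>\<close>.

  \<^item> As \<open>P\<^sub>s \<le> 1\<close>, \<open>- F' \<le> \<lambda> G\<close>, that is \<open>1 - \<lambda>/\<beta> \<le> \<lambda> G\<close>, which is the lower bound.

  \<^item> For the upper bound, the same equation is applied under the weight \<open>L(x, \<Xi>)\<close>, that is, to the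
    reduced Palm process at \<open>x\<close>.  This is again a Gibbs process; its conditional intensity
    \<open>\<phi>(x - y) L(y, \<xi>)\<close> is again at most \<open>\<beta>\<close>.  So \<open>- H\<^sub>x' \<le> \<beta> G H\<^sub>x\<close> and
    \<open>H\<^sub>x(s) \<ge> \<lambda> exp(- \<beta> G s)\<close>.  Integrating, \<open>\<beta> - \<lambda> = \<beta> (1 - F(1)) \<ge> \<lambda> (1 - exp(- \<beta> G))\<close>.

  The differential inequalities are replaced by difference inequalities on the grid \<open>k/n\<close>: as
  \<open>s \<mapsto> P\<^sub>s(\<xi>)\<close> is convex, its increments lie between the two tangents
  (\<open>config_prod_diff\<close>), which gives \<open>palm_avoid_decay\<close> and \<open>mean_avoid_diff\<close>.
  In this form only expectations at fixed \<open>s\<close> occur, and the exponential arises as the limit of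
  \<open>(1 - \<beta> G/n)\<^sup>n\<close> as \<open>n \<rightarrow> \<infinity>\<close>.\<close>

section \<open>Measurability on the space of configurations\<close>

lemma space_configsD: "\<xi> \<in> space configs \<Longrightarrow> bounded A \<Longrightarrow> finite (\<xi> \<inter> A)"
  by (simp add: space_configs locally_finite_set_def)

lemma measurable_card_config:
  fixes A :: "'a::euclidean_space set"
  assumes "A \<in> sets borel" "bounded A"
  shows "(\<lambda>\<xi>. card (\<xi> \<inter> A)) \<in> configs \<rightarrow>\<^sub>M count_space UNIV"
  unfolding configs_def
proof (rule measurable_SUP1)
  show "A \<in> {A \<in> sets borel. bounded A}" using assms by simp
  show "(\<lambda>\<xi>. card (\<xi> \<inter> A)) \<in> vimage_algebra {\<xi>. locally_finite_set \<xi>}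
      (\<lambda>\<xi>. card (\<xi> \<inter> A)) (count_space UNIV) \<rightarrow>\<^sub>M count_space UNIV"
    by (rule measurable_vimage_algebra1) auto
qed auto

text \<open>Indicators of bounded sets are covered by the generators of the \<open>\<sigma>\<close>-algebra; a general
  indicator is the supremum of the indicators of its bounded parts, and a general \<open>f\<close> is reached
  by monotone approximation.\<close>

lemma measurable_config_sum:
  fixes f :: "'a::euclidean_space \<Rightarrow> ennreal"
  assumes "f \<in> borel_measurable borel"
  shows "(\<lambda>\<xi>. \<integral>\<^sup>+y. f y \<partial>count_space \<xi>) \<in> borel_measurable configs"
  using assms
proof (induction f rule: borel_measurable_induct)
  case (cong f g)
  then have "f = g" by auto
  with cong show ?case by simp
next
  case (set A)
  have bdd: "(\<lambda>\<xi>. \<integral>\<^sup>+y. indicator (A \<inter> ball 0 (real n)) y \<partial>count_space \<xi>) \<in> borel_measurable configs"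
    for n :: nat
  proof -
    let ?B = "A \<inter> ball 0 (real n)"
    have B: "?B \<in> sets borel" "bounded ?B"
      using set by (auto intro: bounded_subset[OF bounded_ball])
    have "(\<integral>\<^sup>+y. indicator ?B y \<partial>count_space \<xi>) = of_nat (card (\<xi> \<inter> ?B))"
      if "\<xi> \<in> space configs" for \<xi>
      using space_configsD[OF that B(2)]
      by (subst nn_integral_count_space'[where A = "\<xi> \<inter> ?B"]) auto
    moreover have "(\<lambda>\<xi>. of_nat (card (\<xi> \<inter> ?B)) :: ennreal) \<in> borel_measurable configs"
      using measurable_compose[OF measurable_card_config[OF B], of of_nat "borel :: ennreal measure"]
      by simp
    ultimately show ?thesis by (simp cong: measurable_cong)
  qed
  have sup: "(SUP n. indicator (A \<inter> ball 0 (real n)) y) = (indicator A y :: ennreal)" for y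
  proof (rule antisym)
    show "(SUP n. indicator (A \<inter> ball 0 (real n)) y) \<le> (indicator A y :: ennreal)"
      by (intro SUP_least) (auto simp: indicator_def)
    obtain n :: nat where "norm y < real n" using reals_Archimedean2 by blast
    then show "(indicator A y :: ennreal) \<le> (SUP n. indicator (A \<inter> ball 0 (real n)) y)"
      by (intro SUP_upper2[of n]) (auto simp: indicator_def)
  qed
  have inc: "incseq (\<lambda>n y. indicator (A \<inter> ball 0 (real n)) y :: ennreal)"
    by (auto simp: incseq_def le_fun_def indicator_def)
  have "(\<integral>\<^sup>+y. indicator A y \<partial>count_space \<xi>) =
      (SUP n. \<integral>\<^sup>+y. indicator (A \<inter> ball 0 (real n)) y \<partial>count_space \<xi>)" for \<xi>
    using nn_integral_monotone_convergence_SUP[OF inc, of "count_space \<xi>"] by (simp add: sup)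
  with bdd show ?case by simp
next
  case (mult f c)
  then show ?case by (simp add: nn_integral_cmult)
next
  case (add f g)
  then show ?case by (simp add: nn_integral_add)
next
  case (seq U)
  have "(\<integral>\<^sup>+y. (SUP i. U i) y \<partial>count_space \<xi>) = (SUP i. \<integral>\<^sup>+y. U i y \<partial>count_space \<xi>)" for \<xi>
    unfolding SUP_apply using seq by (intro nn_integral_monotone_convergence_SUP) auto
  with seq show ?case by simp
qed

lemma measurable_translate_configs:
  fixes v :: "'a::euclidean_space"
  shows "(\<lambda>\<xi>. (\<lambda>x. x + v) ` \<xi>) \<in> configs \<rightarrow>\<^sub>M configs"
proof -
  have inter: "((\<lambda>x. x + v) ` \<xi>) \<inter> A = (\<lambda>x. x + v) ` (\<xi> \<inter> (\<lambda>x. x - v) ` A)" for \<xi> A :: "'a set"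
    by (force simp: image_iff)
  have bdd: "bounded ((\<lambda>x. x - v) ` A)" if "bounded A" for A
    using bounded_translation[OF that, of "- v"] by simp
  have lf: "locally_finite_set ((\<lambda>x. x + v) ` \<xi>)" if "locally_finite_set \<xi>" for \<xi>
    using that bdd unfolding locally_finite_set_def inter by blast
  have card: "card (((\<lambda>x. x + v) ` \<xi>) \<inter> A) = card (\<xi> \<inter> (\<lambda>x. x - v) ` A)" for \<xi> A
    unfolding inter by (rule card_image) (auto simp: inj_on_def)
  have borel: "(\<lambda>x. x - v) ` A \<in> sets borel" if "A \<in> sets borel" for A
  proof -
    have "(\<lambda>x. x - v) ` A = (\<lambda>x. x + v) -` A \<inter> space borel"
      by (auto simp: image_iff) (metis add_diff_cancel)
    then show ?thesis using that measurable_sets[of "\<lambda>x. x + v" borel borel A] by simp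
  qed
  let ?I = "{A :: 'a set. A \<in> sets borel \<and> bounded A}"
  have "(\<lambda>\<xi>. (\<lambda>x. x + v) ` \<xi>) \<in> configs \<rightarrow>\<^sub>M
      (SUP A \<in> ?I. vimage_algebra {\<xi>. locally_finite_set \<xi>} (\<lambda>\<xi>. card (\<xi> \<inter> A)) (count_space UNIV))"
  proof (rule measurable_SUP2)
    show "?I \<noteq> {}" by (auto intro: exI[of _ "{}"])
    fix A assume "A \<in> ?I"
    then show "(\<lambda>\<xi>. (\<lambda>x. x + v) ` \<xi>) \<in> configs \<rightarrow>\<^sub>M
        vimage_algebra {\<xi>. locally_finite_set \<xi>} (\<lambda>\<xi>. card (\<xi> \<inter> A)) (count_space UNIV)"
      using lf borel bdd
      by (intro measurable_vimage_algebra2) (auto simp: card space_configs intro!: measurable_card_config)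
  qed auto
  then show ?thesis by (simp add: configs_def)
qed

section \<open>Products over the points of a configuration\<close>

text \<open>Factors equal to \<open>1\<close> are dropped, which makes the product over a locally finite configuration
  a finite one whenever \<open>g\<close> differs from \<open>1\<close> only on a bounded set.\<close>

definition config_prod :: "('a \<Rightarrow> real) \<Rightarrow> 'a set \<Rightarrow> real" where
  "config_prod g \<xi> = (\<Prod>y\<in>{y\<in>\<xi>. g y \<noteq> 1}. g y)"

lemma config_prod_nonneg: "(\<And>y. 0 \<le> g y) \<Longrightarrow> 0 \<le> config_prod g \<xi>"
  by (simp add: config_prod_def prod_nonneg)

lemma config_prod_le_1: "(\<And>y. 0 \<le> g y) \<Longrightarrow> (\<And>y. g y \<le> 1) \<Longrightarrow> config_prod g \<xi> \<le> 1"
  by (simp add: config_prod_def prod_le_1)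

lemma config_prod_eq_prod:
  assumes "finite S" "S \<subseteq> \<xi>" "\<And>y. y \<in> \<xi> - S \<Longrightarrow> g y = 1"
  shows "config_prod g \<xi> = prod g S"
  unfolding config_prod_def using assms by (intro prod.mono_neutral_left) auto

lemma config_prod_remove:
  fixes g :: "'a::euclidean_space \<Rightarrow> real"
  assumes "bounded {y. g y \<noteq> 1}" "\<xi> \<in> space configs" "x \<in> \<xi>"
  shows "config_prod g \<xi> = g x * config_prod g (\<xi> - {x})"
proof -
  let ?S = "\<xi> \<inter> {y. g y \<noteq> 1}"
  have fin: "finite ?S" using assms space_configsD by blast
  have "config_prod g \<xi> = prod g (insert x ?S)"
    using fin assms by (intro config_prod_eq_prod) auto
  also have "\<dots> = g x * prod g (?S - {x})"
    using fin by (simp add: prod.insert_remove)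
  also have "prod g (?S - {x}) = config_prod g (\<xi> - {x})"
    using fin by (intro config_prod_eq_prod[symmetric]) auto
  finally show ?thesis .
qed

lemma config_prod_translate:
  "config_prod g ((\<lambda>x. x + v) ` \<xi>) = config_prod (\<lambda>y. g (y + v)) \<xi>"
  for v :: "'a::ab_group_add"
proof -
  have "{y \<in> (\<lambda>x. x + v) ` \<xi>. g y \<noteq> 1} = (\<lambda>x. x + v) ` {y\<in>\<xi>. g (y + v) \<noteq> 1}" by auto
  then show ?thesis unfolding config_prod_def by (simp add: prod.reindex)
qed

text \<open>The product is the exponential of a sum of logarithms, except that a vanishing factor has no
  logarithm; such factors are detected by counting the zeros of \<open>g\<close> in \<open>\<xi>\<close>.\<close>

lemma measurable_config_prod:
  fixes g :: "'a::euclidean_space \<Rightarrow> real"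
  assumes [measurable]: "g \<in> borel_measurable borel"
    and g: "\<And>y. 0 \<le> g y" "\<And>y. g y \<le> 1" "bounded {y. g y \<noteq> 1}"
  shows "config_prod g \<in> borel_measurable configs"
proof -
  define f where "f y = ennreal (- ln (g y))" for y
  define z where "z y = (indicator {y. g y = 0} y :: ennreal)" for y
  have [measurable]: "f \<in> borel_measurable borel" "z \<in> borel_measurable borel"
    unfolding f_def z_def by measurable
  note [measurable] = measurable_config_sum[of f] measurable_config_sum[of z]
  have "config_prod g \<xi> = (if (\<integral>\<^sup>+y. z y \<partial>count_space \<xi>) = 0
      then exp (- enn2real (\<integral>\<^sup>+y. f y \<partial>count_space \<xi>)) else 0)"
    if "\<xi> \<in> space configs" for \<xi>
  proof -
    let ?S = "{y\<in>\<xi>. g y \<noteq> 1}"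
    have fin: "finite ?S"
      using space_configsD[OF that g(3)] by (simp add: Int_def)
    have Z: "(\<integral>\<^sup>+y. z y \<partial>count_space \<xi>) = 0 \<longleftrightarrow> (\<forall>y\<in>\<xi>. g y \<noteq> 0)"
      by (subst nn_integral_0_iff_AE) (auto simp: AE_count_space z_def indicator_def)
    have "exp (- enn2real (\<integral>\<^sup>+y. f y \<partial>count_space \<xi>)) = config_prod g \<xi>"
      if nz: "\<forall>y\<in>\<xi>. g y \<noteq> 0"
    proof -
      have pos: "0 < g y" if "y \<in> \<xi>" for y using nz g(1)[of y] that by (auto simp: less_le)
      have ln0: "0 \<le> - ln (g y)" if "y \<in> \<xi>" for y using pos[OF that] g(2)[of y] by simp
      have "(\<integral>\<^sup>+y. f y \<partial>count_space \<xi>) = (\<Sum>y\<in>?S. f y)"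
        using fin by (intro nn_integral_count_space') (auto simp: f_def)
      also have "\<dots> = ennreal (\<Sum>y\<in>?S. - ln (g y))"
        unfolding f_def using ln0 by (intro sum_ennreal) auto
      finally have "enn2real (\<integral>\<^sup>+y. f y \<partial>count_space \<xi>) = (\<Sum>y\<in>?S. - ln (g y))"
        using sum_nonneg[of ?S "\<lambda>y. - ln (g y)"] ln0 by simp
      then have "exp (- enn2real (\<integral>\<^sup>+y. f y \<partial>count_space \<xi>)) = exp (\<Sum>y\<in>?S. ln (g y))"
        by (simp add: sum_negf)
      also have "\<dots> = prod g ?S"
        using fin pos by (simp add: exp_sum)
      finally show ?thesis by (simp add: config_prod_def)
    qed
    moreover have "config_prod g \<xi> = 0" if "\<not> (\<forall>y\<in>\<xi>. g y \<noteq> 0)"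
      unfolding config_prod_def using that fin by (intro prod_zero) auto
    ultimately show ?thesis using Z by auto
  qed
  then show ?thesis by (simp cong: measurable_cong)
qed

lemma config_prod_mono:
  fixes a b :: "'a::euclidean_space \<Rightarrow> real"
  assumes \<xi>: "\<xi> \<in> space configs" and ab: "\<And>y. 0 \<le> b y" "\<And>y. b y \<le> a y" "\<And>y. a y \<le> 1"
    and bdd: "bounded {y. b y \<noteq> 1}"
  shows "config_prod b \<xi> \<le> config_prod a \<xi>"
proof -
  let ?S = "\<xi> \<inter> {y. b y \<noteq> 1}"
  have fin: "finite ?S" by (rule space_configsD[OF \<xi> bdd])
  have "a y = 1" if "b y = 1" for y using ab(2,3)[of y] that by simp
  then have "config_prod a \<xi> = prod a ?S" "config_prod b \<xi> = prod b ?S"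
    using fin by (auto intro!: config_prod_eq_prod)
  then show ?thesis using ab by (auto intro: prod_mono)
qed

text \<open>Replacing the factors \<open>a\<close> by the smaller factors \<open>b\<close> one at a time, each step changes the
  product by \<open>a y - b y\<close> times a mixed product of the other factors, and this mixed product lies
  between the pure ones.\<close>

lemma prod_diff_le_sum:
  fixes a b :: "'a \<Rightarrow> real"
  assumes "finite S" "\<And>y. 0 \<le> b y" "\<And>y. b y \<le> a y"
  shows "prod a S - prod b S \<le> (\<Sum>y\<in>S. (a y - b y) * prod a (S - {y}))"
    and "(\<Sum>y\<in>S. (a y - b y) * prod b (S - {y})) \<le> prod a S - prod b S"
  using assms(1)
proof (induction S rule: finite_induct)
  case (insert x S)
  have ba: "prod b S \<le> prod a S" using assms by (intro prod_mono) auto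
  have ax: "0 \<le> b x" "b x \<le> a x" using assms by auto
  have split: "(\<Sum>y\<in>insert x S. (a y - b y) * prod c (insert x S - {y})) =
      (a x - b x) * prod c S + c x * (\<Sum>y\<in>S. (a y - b y) * prod c (S - {y}))" for c :: "'a \<Rightarrow> real"
  proof -
    have "prod c (insert x S - {y}) = c x * prod c (S - {y})" if "y \<in> S" for y
    proof -
      have "insert x S - {y} = insert x (S - {y})" "x \<notin> S - {y}" using that insert by auto
      then show ?thesis using insert by simp
    qed
    then have "(\<Sum>y\<in>S. (a y - b y) * prod c (insert x S - {y})) =
        (\<Sum>y\<in>S. c x * ((a y - b y) * prod c (S - {y})))"
      by (intro sum.cong) auto
    then show ?thesis using insert by (simp add: sum_distrib_left)
  qed
  { case 1
    have "prod a (insert x S) - prod b (insert x S) =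
        (a x - b x) * prod b S + a x * (prod a S - prod b S)"
      using insert by (simp add: algebra_simps)
    also have "\<dots> \<le> (a x - b x) * prod a S + a x * (\<Sum>y\<in>S. (a y - b y) * prod a (S - {y}))"
      using ba ax insert.IH(1) by (intro add_mono mult_left_mono) auto
    finally show ?case by (simp add: split) }
  { case 2
    have "prod a (insert x S) - prod b (insert x S) =
        (a x - b x) * prod a S + b x * (prod a S - prod b S)"
      using insert by (simp add: algebra_simps)
    also have "\<dots> \<ge> (a x - b x) * prod b S + b x * (\<Sum>y\<in>S. (a y - b y) * prod b (S - {y}))"
      using ba ax insert.IH(2) by (intro add_mono mult_left_mono) auto
    finally show ?case by (simp add: split) }
qed auto

text \<open>The two sums have the shape of the left-hand side of the Georgii-Nguyen-Zessin equation: the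
  summand at \<open>y\<close> is a function of \<open>y\<close> and of the configuration without \<open>y\<close>.\<close>

lemma config_prod_diff:
  fixes a b :: "'a::euclidean_space \<Rightarrow> real"
  assumes \<xi>: "\<xi> \<in> space configs" and ab: "\<And>y. 0 \<le> b y" "\<And>y. b y \<le> a y" "\<And>y. a y \<le> 1"
    and bdd: "bounded {y. b y \<noteq> 1}"
  shows "ennreal (config_prod a \<xi> - config_prod b \<xi>) \<le>
      (\<integral>\<^sup>+y. ennreal ((a y - b y) * config_prod a (\<xi> - {y})) \<partial>count_space \<xi>)"
    and "(\<integral>\<^sup>+y. ennreal ((a y - b y) * config_prod b (\<xi> - {y})) \<partial>count_space \<xi>) \<le>
      ennreal (config_prod a \<xi> - config_prod b \<xi>)"
proof -
  let ?S = "{y\<in>\<xi>. b y \<noteq> 1}"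
  have fin: "finite ?S"
    using space_configsD[OF \<xi> bdd] by (simp add: Int_def)
  have a1: "a y = 1" if "b y = 1" for y using ab(2,3)[of y] that by simp
  have sum: "(\<integral>\<^sup>+y. ennreal ((a y - b y) * config_prod c (\<xi> - {y})) \<partial>count_space \<xi>) =
      ennreal (\<Sum>y\<in>?S. (a y - b y) * prod c (?S - {y}))"
    if c: "\<And>y. 0 \<le> c y" "\<And>y. b y = 1 \<Longrightarrow> c y = 1" for c :: "'a \<Rightarrow> real"
  proof -
    have "(\<integral>\<^sup>+y. ennreal ((a y - b y) * config_prod c (\<xi> - {y})) \<partial>count_space \<xi>) =
        (\<Sum>y\<in>?S. ennreal ((a y - b y) * config_prod c (\<xi> - {y})))"
      using fin a1 by (intro nn_integral_count_space') auto
    also have "\<dots> = (\<Sum>y\<in>?S. ennreal ((a y - b y) * prod c (?S - {y})))"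
    proof (intro sum.cong refl)
      fix y assume "y \<in> ?S"
      have "config_prod c (\<xi> - {y}) = prod c (?S - {y})"
        using fin c(2) by (intro config_prod_eq_prod) auto
      then show "ennreal ((a y - b y) * config_prod c (\<xi> - {y})) =
          ennreal ((a y - b y) * prod c (?S - {y}))" by simp
    qed
    also have "\<dots> = ennreal (\<Sum>y\<in>?S. (a y - b y) * prod c (?S - {y}))"
      using ab c by (intro sum_ennreal mult_nonneg_nonneg prod_nonneg) auto
    finally show ?thesis .
  qed
  have prods: "config_prod a \<xi> = prod a ?S" "config_prod b \<xi> = prod b ?S"
    using fin a1 by (auto intro!: config_prod_eq_prod)
  have a0: "0 \<le> a y" for y using ab(1,2)[of y] by linarith
  show "ennreal (config_prod a \<xi> - config_prod b \<xi>) \<le>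
      (\<integral>\<^sup>+y. ennreal ((a y - b y) * config_prod a (\<xi> - {y})) \<partial>count_space \<xi>)"
    using a0 a1 prod_diff_le_sum(1)[of ?S b a] fin ab by (simp add: sum prods ennreal_leI)
  show "(\<integral>\<^sup>+y. ennreal ((a y - b y) * config_prod b (\<xi> - {y})) \<partial>count_space \<xi>) \<le>
      ennreal (config_prod a \<xi> - config_prod b \<xi>)"
    using prod_diff_le_sum(2)[of ?S b a] fin ab by (simp add: sum prods ennreal_leI)
qed

section \<open>Inhibitory pairwise interaction processes\<close>

locale inhibitory_PIP =
  fixes M :: "'w measure" and \<Xi> :: "'w \<Rightarrow> 'a::euclidean_space set"
    and \<beta> :: real and \<phi> :: "'a \<Rightarrow> real"
  assumes PIP: "PIP M \<Xi> \<beta> \<phi>" and inhibitory: "inhibitory \<phi>" and finite_range: "finite_range \<phi>"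
begin

lemma beta_pos: "0 < \<beta>"
  and phi_measurable [measurable]: "\<phi> \<in> borel_measurable borel"
  and phi_nonneg: "0 \<le> \<phi> x"
  and phi_le_1: "\<phi> x \<le> 1"
  and phi_minus: "\<phi> (- x) = \<phi> x"
  and process_measurable [measurable]: "\<Xi> \<in> M \<rightarrow>\<^sub>M configs"
  using PIP inhibitory by (auto simp: PIP_def inhibitory_def gibbs_process_def point_process_def)

sublocale prob_space M
  using PIP by (simp add: PIP_def gibbs_process_def point_process_def)

lemma process_in_configs: "\<omega> \<in> space M \<Longrightarrow> \<Xi> \<omega> \<in> space configs"
  using measurable_space[OF process_measurable] .

lemma bounded_range: "bounded {y. \<phi> y \<noteq> 1}"
proof -
  have "{y. \<phi> y \<noteq> 1} \<subseteq> closure {x. 1 - \<phi> x \<noteq> 0}"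
    using closure_subset[of "{x. 1 - \<phi> x \<noteq> 0}"] by auto
  then show ?thesis
    using finite_range unfolding finite_range_def by (meson bounded_subset compact_imp_bounded)
qed

lemma bounded_range_shift: "bounded {y. \<phi> (x - y) \<noteq> 1}"
proof -
  have "{y. \<phi> (x - y) \<noteq> 1} = (\<lambda>z. - z + x) ` {z. \<phi> z \<noteq> 1}"
    by (auto simp: image_iff intro!: exI[of _ "x - _"])
  moreover have "bounded ((\<lambda>z. - z + x) ` {z. \<phi> z \<noteq> 1})"
    using bounded_translation[OF bounded_uminus[THEN iffD2, OF bounded_range], of x]
    by (simp add: image_image add.commute)
  ultimately show ?thesis by simp
qed

definition G :: real where "G = (\<integral>x. (1 - \<phi> x) \<partial>lborel)"

lemma nn_integral_phi: "(\<integral>\<^sup>+x. ennreal (1 - \<phi> x) \<partial>lborel) = ennreal G"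
proof -
  obtain r where r: "\<And>y. \<phi> y \<noteq> 1 \<Longrightarrow> norm y \<le> r"
    using bounded_range by (auto simp: bounded_iff)
  have "(\<integral>\<^sup>+x. ennreal (1 - \<phi> x) \<partial>lborel) \<le> (\<integral>\<^sup>+x. indicator (cball (0 :: 'a) r) x \<partial>lborel)"
  proof (intro nn_integral_mono)
    fix x
    show "ennreal (1 - \<phi> x) \<le> indicator (cball 0 r) x"
      using r[of x] phi_nonneg[of x] by (cases "\<phi> x = 1") (auto simp: indicator_def ennreal_le_1)
  qed
  also have "\<dots> < \<infinity>" using emeasure_bounded_finite[OF bounded_cball] by simp
  finally have "integrable lborel (\<lambda>x. 1 - \<phi> x)"
    using phi_le_1 by (intro integrableI_nonneg) auto
  then show ?thesis
    unfolding G_def using phi_le_1 by (intro nn_integral_eq_integral) auto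
qed

lemma G_nonneg: "0 \<le> G"
  unfolding G_def using phi_le_1 by (intro integral_nonneg_AE) auto

lemma beta_G_nonneg: "0 \<le> \<beta> * G"
  using beta_pos G_nonneg by simp

text \<open>The conditional intensity as a finite product; unlike the limit along finite subsets it is
  nonnegative on all sets of points, locally finite or not, as the test functions in the
  Georgii-Nguyen-Zessin equation must be.\<close>

definition L :: "'a \<Rightarrow> 'a set \<Rightarrow> real" where
  "L x \<xi> = \<beta> * config_prod (\<lambda>y. \<phi> (x - y)) \<xi>"

lemma pip_cond_intensity_eq: "\<xi> \<in> space configs \<Longrightarrow> pip_cond_intensity \<beta> \<phi> x \<xi> = L x \<xi>"
  using pip_cond_intensity_finite_range(2)[OF finite_range]
  by (simp add: L_def config_prod_def)

lemma L_nonneg: "0 \<le> L x \<xi>"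
  using beta_pos phi_nonneg by (simp add: L_def config_prod_nonneg)

lemma L_le: "L x \<xi> \<le> \<beta>"
  using beta_pos phi_nonneg phi_le_1 by (simp add: L_def config_prod_le_1 mult_le_cancel_left1)

lemma L_measurable [measurable]: "L x \<in> borel_measurable configs"
  unfolding L_def[abs_def]
  by (intro borel_measurable_times borel_measurable_const measurable_config_prod
      bounded_range_shift phi_nonneg phi_le_1) measurable

lemma L_remove: "\<xi> \<in> space configs \<Longrightarrow> y \<in> \<xi> \<Longrightarrow> L x \<xi> = L x (\<xi> - {y}) * \<phi> (x - y)"
  by (simp add: L_def config_prod_remove[OF bounded_range_shift])

lemma L_translate: "L x \<xi> = L 0 ((\<lambda>y. y - x) ` \<xi>)"
  using config_prod_translate[of "\<lambda>y. \<phi> (- y)" "- x" \<xi>] by (simp add: L_def)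

lemma georgii_nguyen_zessin:
  assumes "h \<in> borel_measurable (borel \<Otimes>\<^sub>M configs)" "\<And>p. 0 \<le> h p"
  shows "(\<integral>\<^sup>+\<omega>. (\<integral>\<^sup>+y. ennreal (h (y, \<Xi> \<omega> - {y})) \<partial>count_space (\<Xi> \<omega>)) \<partial>M) =
    (\<integral>\<^sup>+y. (\<integral>\<^sup>+\<omega>. ennreal (h (y, \<Xi> \<omega>) * L y (\<Xi> \<omega>)) \<partial>M) \<partial>lborel)"
proof -
  have "(\<integral>\<^sup>+\<omega>. (\<integral>\<^sup>+y. ennreal (h (y, \<Xi> \<omega> - {y})) \<partial>count_space (\<Xi> \<omega>)) \<partial>M) =
      (\<integral>\<^sup>+y. (\<integral>\<^sup>+\<omega>. ennreal (h (y, \<Xi> \<omega>) * pip_cond_intensity \<beta> \<phi> y (\<Xi> \<omega>)) \<partial>M) \<partial>lborel)"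
    using PIP assms by (simp add: PIP_def gibbs_process_def)
  also have "\<dots> = (\<integral>\<^sup>+y. (\<integral>\<^sup>+\<omega>. ennreal (h (y, \<Xi> \<omega>) * L y (\<Xi> \<omega>)) \<partial>M) \<partial>lborel)"
    by (intro nn_integral_cong) (simp add: pip_cond_intensity_eq process_in_configs)
  finally show ?thesis .
qed

text \<open>This is the probability that no point of \<open>\<xi>\<close> is selected if each point \<open>y\<close> is selected
  independently with probability \<open>s * (1 - \<phi> y)\<close>.  It interpolates between \<open>1\<close> at \<open>s = 0\<close> and
  \<open>L 0 \<xi> / \<beta>\<close> at \<open>s = 1\<close>.\<close>

definition avoid :: "real \<Rightarrow> 'a set \<Rightarrow> real" where
  "avoid s = config_prod (\<lambda>y. 1 - s * (1 - \<phi> y))"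

lemma factor_bounds:
  assumes "0 \<le> s" "s \<le> 1"
  shows "0 \<le> 1 - s * (1 - \<phi> y)" "1 - s * (1 - \<phi> y) \<le> 1"
  using assms mult_le_one[of s "1 - \<phi> y"] phi_nonneg[of y] phi_le_1[of y] by auto

lemma factor_bounded: "bounded {y. 1 - s * (1 - \<phi> y) \<noteq> 1}"
  by (rule bounded_subset[OF bounded_range]) auto

lemma avoid_nonneg: "0 \<le> s \<Longrightarrow> s \<le> 1 \<Longrightarrow> 0 \<le> avoid s \<xi>"
  unfolding avoid_def by (intro config_prod_nonneg factor_bounds)

lemma avoid_le_1: "0 \<le> s \<Longrightarrow> s \<le> 1 \<Longrightarrow> avoid s \<xi> \<le> 1"
  unfolding avoid_def by (intro config_prod_le_1 factor_bounds)

lemma avoid_0: "avoid 0 \<xi> = 1"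
  by (simp add: avoid_def config_prod_def)

lemma avoid_1: "\<beta> * avoid 1 \<xi> = L 0 \<xi>"
  by (simp add: avoid_def L_def phi_minus)

lemma avoid_measurable [measurable]: "0 \<le> s \<Longrightarrow> s \<le> 1 \<Longrightarrow> avoid s \<in> borel_measurable configs"
  unfolding avoid_def by (intro measurable_config_prod factor_bounds factor_bounded) measurable

lemma
  assumes "\<xi> \<in> space configs" "0 \<le> s" "s \<le> t" "t \<le> 1"
  shows avoid_antimono: "avoid t \<xi> \<le> avoid s \<xi>"
    and avoid_diff_le: "ennreal (avoid s \<xi> - avoid t \<xi>) \<le>
      (\<integral>\<^sup>+y. ennreal ((t - s) * (1 - \<phi> y) * avoid s (\<xi> - {y})) \<partial>count_space \<xi>)"
    and avoid_diff_ge: "(\<integral>\<^sup>+y. ennreal ((t - s) * (1 - \<phi> y) * avoid t (\<xi> - {y})) \<partial>count_space \<xi>) \<le>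
      ennreal (avoid s \<xi> - avoid t \<xi>)"
proof -
  have ord: "1 - t * (1 - \<phi> y) \<le> 1 - s * (1 - \<phi> y)" for y
    using assms phi_le_1 by (simp add: mult_right_mono)
  have diff: "1 - s * (1 - \<phi> y) - (1 - t * (1 - \<phi> y)) = (t - s) * (1 - \<phi> y)" for y
    by (simp add: algebra_simps)
  have t: "0 \<le> t" and s: "s \<le> 1" using assms by auto
  note prems = assms(1) factor_bounds(1)[OF t assms(4)] ord factor_bounds(2)[OF assms(2) s] factor_bounded
  show "avoid t \<xi> \<le> avoid s \<xi>"
    unfolding avoid_def by (rule config_prod_mono[OF prems])
  show "ennreal (avoid s \<xi> - avoid t \<xi>) \<le>
      (\<integral>\<^sup>+y. ennreal ((t - s) * (1 - \<phi> y) * avoid s (\<xi> - {y})) \<partial>count_space \<xi>)"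
    using config_prod_diff(1)[OF prems] by (simp add: avoid_def diff)
  show "(\<integral>\<^sup>+y. ennreal ((t - s) * (1 - \<phi> y) * avoid t (\<xi> - {y})) \<partial>count_space \<xi>) \<le>
      ennreal (avoid s \<xi> - avoid t \<xi>)"
    using config_prod_diff(2)[OF prems] by (simp add: avoid_def diff)
qed

definition mean_avoid :: "real \<Rightarrow> real" where
  "mean_avoid s = (\<integral>\<omega>. avoid s (\<Xi> \<omega>) \<partial>M)"

text \<open>Divided by the intensity, this is the mean of \<open>avoid s\<close> under the reduced Palm distribution
  at \<open>x\<close>.\<close>

definition palm_avoid :: "'a \<Rightarrow> real \<Rightarrow> real" where
  "palm_avoid x s = (\<integral>\<omega>. L x (\<Xi> \<omega>) * avoid s (\<Xi> \<omega>) \<partial>M)"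

lemma integrable_avoid: "0 \<le> s \<Longrightarrow> s \<le> 1 \<Longrightarrow> integrable M (\<lambda>\<omega>. avoid s (\<Xi> \<omega>))"
  using avoid_nonneg avoid_le_1 by (intro integrable_const_bound[of _ 1]) auto

lemma integrable_palm_avoid:
  assumes "0 \<le> s" "s \<le> 1"
  shows "integrable M (\<lambda>\<omega>. L x (\<Xi> \<omega>) * avoid s (\<Xi> \<omega>))"
proof (rule integrable_const_bound[of _ \<beta>])
  note [measurable] = avoid_measurable[OF assms]
  show "(\<lambda>\<omega>. L x (\<Xi> \<omega>) * avoid s (\<Xi> \<omega>)) \<in> borel_measurable M" by measurable
  have "L x \<xi> * avoid s \<xi> \<le> \<beta> * 1" for \<xi>
    using L_le avoid_le_1[OF assms] avoid_nonneg[OF assms] beta_pos by (intro mult_mono) auto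
  then show "AE \<omega> in M. norm (L x (\<Xi> \<omega>) * avoid s (\<Xi> \<omega>)) \<le> \<beta>"
    using L_nonneg avoid_nonneg[OF assms] by simp
qed

lemma palm_avoid_nonneg: "0 \<le> s \<Longrightarrow> s \<le> 1 \<Longrightarrow> 0 \<le> palm_avoid x s"
  unfolding palm_avoid_def using avoid_nonneg L_nonneg by (intro integral_nonneg_AE) auto

lemma nn_integral_palm_avoid:
  assumes "0 \<le> s" "s \<le> 1" "0 \<le> c"
  shows "(\<integral>\<^sup>+\<omega>. ennreal (c * (L x (\<Xi> \<omega>) * avoid s (\<Xi> \<omega>))) \<partial>M) = ennreal (c * palm_avoid x s)"
proof -
  have "(\<integral>\<^sup>+\<omega>. ennreal (c * (L x (\<Xi> \<omega>) * avoid s (\<Xi> \<omega>))) \<partial>M) =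
      ennreal (\<integral>\<omega>. c * (L x (\<Xi> \<omega>) * avoid s (\<Xi> \<omega>)) \<partial>M)"
    using assms integrable_palm_avoid avoid_nonneg L_nonneg
    by (intro nn_integral_eq_integral) auto
  then show ?thesis by (simp add: palm_avoid_def)
qed

lemma nn_integral_scaled_phi:
  assumes "0 \<le> c"
  shows "(\<integral>\<^sup>+y. ennreal (c * (1 - \<phi> y)) \<partial>lborel) = ennreal (c * G)"
proof -
  have "(\<integral>\<^sup>+y. ennreal (c * (1 - \<phi> y)) \<partial>lborel) =
      (\<integral>\<^sup>+y. ennreal c * ennreal (1 - \<phi> y) \<partial>lborel)"
    by (intro nn_integral_cong ennreal_mult'[OF assms])
  also have "\<dots> = ennreal c * (\<integral>\<^sup>+y. ennreal (1 - \<phi> y) \<partial>lborel)"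
    by (rule nn_integral_cmult) measurable
  also have "\<dots> = ennreal (c * G)"
    unfolding nn_integral_phi by (rule ennreal_mult'[OF assms, symmetric])
  finally show ?thesis .
qed

text \<open>Shifting the process by \<open>- x\<close> moves \<open>x\<close> to the origin and leaves the law unchanged.\<close>

lemma palm_avoid_0: "palm_avoid x 0 = intensity M \<Xi> (pip_cond_intensity \<beta> \<phi>)"
proof -
  have tr: "(\<lambda>\<xi>. (\<lambda>y. y + - x) ` \<xi>) \<in> configs \<rightarrow>\<^sub>M configs"
    by (rule measurable_translate_configs)
  have "palm_avoid x 0 = (\<integral>\<omega>. L 0 ((\<lambda>y. y + - x) ` \<Xi> \<omega>) \<partial>M)"
    by (simp add: palm_avoid_def avoid_0 L_translate[of x])
  also have "\<dots> = (\<integral>\<xi>. L 0 \<xi> \<partial>distr M configs (\<lambda>\<omega>. (\<lambda>y. y + - x) ` \<Xi> \<omega>))"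
    by (intro integral_distr[symmetric] measurable_compose[OF process_measurable tr] L_measurable)
  also have "distr M configs (\<lambda>\<omega>. (\<lambda>y. y + - x) ` \<Xi> \<omega>) = distr M configs \<Xi>"
    using PIP unfolding PIP_def stationary_def by blast
  also have "(\<integral>\<xi>. L 0 \<xi> \<partial>distr M configs \<Xi>) = (\<integral>\<omega>. L 0 (\<Xi> \<omega>) \<partial>M)"
    by (intro integral_distr) measurable
  also have "\<dots> = intensity M \<Xi> (pip_cond_intensity \<beta> \<phi>)"
    unfolding intensity_def
    by (intro Bochner_Integration.integral_cong) (auto simp: pip_cond_intensity_eq process_in_configs)
  finally show ?thesis .
qed

text \<open>The weight \<open>L x \<xi>\<close> splits off the factor \<open>\<phi> (x - y)\<close> when \<open>y\<close> is removed from \<open>\<xi>\<close>.  So after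
  the Georgii-Nguyen-Zessin equation the integrand at \<open>y\<close> carries the weight
  \<open>L x \<xi> * (\<phi> (x - y) * L y \<xi>)\<close>, and the bracket, the conditional intensity at \<open>y\<close> given \<open>\<xi>\<close> together
  with a point at \<open>x\<close>, is at most \<open>\<beta>\<close>: what remains is \<open>\<beta>\<close> times the original weight.\<close>

lemma palm_avoid_decay:
  assumes st: "0 \<le> s" "s \<le> t" "t \<le> 1"
  shows "(1 - (t - s) * (\<beta> * G)) * palm_avoid x s \<le> palm_avoid x t"
proof -
  have s1: "s \<le> 1" and t0: "0 \<le> t" using st by auto
  note [measurable] = avoid_measurable[OF st(1) s1]
  define h where "h = (\<lambda>(y, \<xi>). (t - s) * (1 - \<phi> y) * avoid s \<xi> * (L x \<xi> * \<phi> (x - y)))"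
  have h_nonneg: "0 \<le> h p" for p
    using st phi_le_1 phi_nonneg avoid_nonneg[OF st(1) s1] L_nonneg
    by (auto simp: h_def split: prod.split intro!: mult_nonneg_nonneg)
  have h_meas: "h \<in> borel_measurable (borel \<Otimes>\<^sub>M configs)"
    unfolding h_def by measurable
  have pointwise: "ennreal (L x \<xi> * (avoid s \<xi> - avoid t \<xi>)) \<le>
      (\<integral>\<^sup>+y. ennreal (h (y, \<xi> - {y})) \<partial>count_space \<xi>)" if "\<xi> \<in> space configs" for \<xi>
  proof -
    have "ennreal (L x \<xi> * (avoid s \<xi> - avoid t \<xi>)) \<le> ennreal (L x \<xi>) *
        (\<integral>\<^sup>+y. ennreal ((t - s) * (1 - \<phi> y) * avoid s (\<xi> - {y})) \<partial>count_space \<xi>)"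
      using avoid_diff_le[OF that st] L_nonneg by (simp add: ennreal_mult' mult_left_mono)
    also have "\<dots> = (\<integral>\<^sup>+y. ennreal (L x \<xi>) *
        ennreal ((t - s) * (1 - \<phi> y) * avoid s (\<xi> - {y})) \<partial>count_space \<xi>)"
      by (simp add: nn_integral_cmult)
    also have "\<dots> = (\<integral>\<^sup>+y. ennreal (h (y, \<xi> - {y})) \<partial>count_space \<xi>)"
    proof (intro nn_integral_cong)
      fix y assume "y \<in> space (count_space \<xi>)"
      then have "L x \<xi> = L x (\<xi> - {y}) * \<phi> (x - y)" using L_remove[OF that] by simp
      then show "ennreal (L x \<xi>) * ennreal ((t - s) * (1 - \<phi> y) * avoid s (\<xi> - {y})) =
          ennreal (h (y, \<xi> - {y}))"
        using L_nonneg[of x \<xi>] by (simp add: h_def ennreal_mult'[symmetric] mult_ac)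
    qed
    finally show ?thesis .
  qed
  have "palm_avoid x s - palm_avoid x t = (\<integral>\<omega>. L x (\<Xi> \<omega>) * (avoid s (\<Xi> \<omega>) - avoid t (\<Xi> \<omega>)) \<partial>M)"
    unfolding palm_avoid_def using integrable_palm_avoid st s1 t0 by (simp add: right_diff_distrib)
  also have "ennreal \<dots> = (\<integral>\<^sup>+\<omega>. ennreal (L x (\<Xi> \<omega>) * (avoid s (\<Xi> \<omega>) - avoid t (\<Xi> \<omega>))) \<partial>M)"
    using integrable_palm_avoid st s1 t0 L_nonneg avoid_antimono process_in_configs
    by (intro nn_integral_eq_integral[symmetric]) (auto simp: right_diff_distrib mult_left_mono)
  also have "\<dots> \<le> (\<integral>\<^sup>+\<omega>. (\<integral>\<^sup>+y. ennreal (h (y, \<Xi> \<omega> - {y})) \<partial>count_space (\<Xi> \<omega>)) \<partial>M)"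
    using pointwise process_in_configs by (intro nn_integral_mono) auto
  also have "\<dots> = (\<integral>\<^sup>+y. (\<integral>\<^sup>+\<omega>. ennreal (h (y, \<Xi> \<omega>) * L y (\<Xi> \<omega>)) \<partial>M) \<partial>lborel)"
    by (rule georgii_nguyen_zessin[OF h_meas h_nonneg])
  also have "\<dots> \<le> (\<integral>\<^sup>+y. (\<integral>\<^sup>+\<omega>. ennreal ((t - s) * (1 - \<phi> y) * \<beta> *
      (L x (\<Xi> \<omega>) * avoid s (\<Xi> \<omega>))) \<partial>M) \<partial>lborel)"
  proof (intro nn_integral_mono ennreal_leI)
    fix y \<omega>
    let ?c = "(t - s) * (1 - \<phi> y)" and ?w = "L x (\<Xi> \<omega>) * avoid s (\<Xi> \<omega>)"
    have nn: "0 \<le> ?c" "0 \<le> ?w" using st phi_le_1 L_nonneg avoid_nonneg s1 by auto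
    have "\<phi> (x - y) * L y (\<Xi> \<omega>) \<le> 1 * \<beta>"
      using phi_le_1 phi_nonneg L_nonneg L_le by (intro mult_mono) auto
    then have "?c * ?w * (\<phi> (x - y) * L y (\<Xi> \<omega>)) \<le> ?c * ?w * \<beta>"
      using nn by (intro mult_left_mono) auto
    then show "h (y, \<Xi> \<omega>) * L y (\<Xi> \<omega>) \<le> (t - s) * (1 - \<phi> y) * \<beta> * (L x (\<Xi> \<omega>) * avoid s (\<Xi> \<omega>))"
      by (simp add: h_def mult_ac)
  qed
  also have "\<dots> = (\<integral>\<^sup>+y. ennreal (((t - s) * \<beta> * palm_avoid x s) * (1 - \<phi> y)) \<partial>lborel)"
    using st s1 phi_le_1 beta_pos by (subst nn_integral_palm_avoid) (auto simp: mult_ac)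
  also have "\<dots> = ennreal (((t - s) * \<beta> * palm_avoid x s) * G)"
    using st s1 beta_pos palm_avoid_nonneg by (intro nn_integral_scaled_phi) auto
  finally have "palm_avoid x s - palm_avoid x t \<le> ((t - s) * \<beta> * palm_avoid x s) * G"
    using st s1 beta_pos palm_avoid_nonneg G_nonneg by (subst (asm) ennreal_le_iff) auto
  then show ?thesis by (simp add: algebra_simps)
qed

text \<open>Both parts bound a drop of the mean by \<open>(t - s) * (\<integral>y. (1 - \<phi> y) * palm_avoid y r)\<close>, from above
  with \<open>r = s\<close> and from below with \<open>r = t\<close>, the two ends of the step.\<close>

lemma mean_avoid_diff:
  assumes st: "0 \<le> s" "s \<le> t" "t \<le> 1"
  shows "(\<And>x. palm_avoid x s \<le> c) \<Longrightarrow> mean_avoid s - mean_avoid t \<le> (t - s) * c * G"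
    and "0 \<le> c \<Longrightarrow> (\<And>x. c \<le> palm_avoid x t) \<Longrightarrow> (t - s) * c * G \<le> mean_avoid s - mean_avoid t"
proof -
  have s1: "s \<le> 1" and t0: "0 \<le> t" using st by auto
  have campbell: "(\<integral>\<^sup>+\<omega>. (\<integral>\<^sup>+y. ennreal ((t - s) * (1 - \<phi> y) * avoid r (\<Xi> \<omega> - {y}))
      \<partial>count_space (\<Xi> \<omega>)) \<partial>M) = (\<integral>\<^sup>+y. ennreal ((t - s) * (1 - \<phi> y) * palm_avoid y r) \<partial>lborel)"
    if r: "0 \<le> r" "r \<le> 1" for r
  proof -
    note [measurable] = avoid_measurable[OF r]
    define h where "h = (\<lambda>(y, \<xi>). (t - s) * (1 - \<phi> y) * avoid r \<xi>)"
    have "0 \<le> h p" for p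
      using st phi_le_1 avoid_nonneg[OF r]
      by (auto simp: h_def split: prod.split intro!: mult_nonneg_nonneg)
    moreover have "h \<in> borel_measurable (borel \<Otimes>\<^sub>M configs)"
      unfolding h_def by measurable
    ultimately have "(\<integral>\<^sup>+\<omega>. (\<integral>\<^sup>+y. ennreal (h (y, \<Xi> \<omega> - {y})) \<partial>count_space (\<Xi> \<omega>)) \<partial>M) =
        (\<integral>\<^sup>+y. (\<integral>\<^sup>+\<omega>. ennreal (h (y, \<Xi> \<omega>) * L y (\<Xi> \<omega>)) \<partial>M) \<partial>lborel)"
      by (intro georgii_nguyen_zessin)
    also have "\<dots> = (\<integral>\<^sup>+y. (\<integral>\<^sup>+\<omega>. ennreal ((t - s) * (1 - \<phi> y) *
        (L y (\<Xi> \<omega>) * avoid r (\<Xi> \<omega>))) \<partial>M) \<partial>lborel)"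
      by (simp add: h_def mult_ac)
    also have "\<dots> = (\<integral>\<^sup>+y. ennreal ((t - s) * (1 - \<phi> y) * palm_avoid y r) \<partial>lborel)"
      using st r phi_le_1 by (subst nn_integral_palm_avoid) auto
    finally show ?thesis by (simp add: h_def)
  qed
  have drop: "ennreal (mean_avoid s - mean_avoid t) =
      (\<integral>\<^sup>+\<omega>. ennreal (avoid s (\<Xi> \<omega>) - avoid t (\<Xi> \<omega>)) \<partial>M)"
  proof -
    have "mean_avoid s - mean_avoid t = (\<integral>\<omega>. avoid s (\<Xi> \<omega>) - avoid t (\<Xi> \<omega>) \<partial>M)"
      unfolding mean_avoid_def using integrable_avoid st s1 t0 by simp
    also have "ennreal \<dots> = (\<integral>\<^sup>+\<omega>. ennreal (avoid s (\<Xi> \<omega>) - avoid t (\<Xi> \<omega>)) \<partial>M)"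
      using integrable_avoid st s1 t0 avoid_antimono process_in_configs
      by (intro nn_integral_eq_integral[symmetric]) auto
    finally show ?thesis .
  qed
  { assume c: "\<And>x. palm_avoid x s \<le> c"
    then have c0: "0 \<le> c" using palm_avoid_nonneg[OF st(1) s1] order_trans by blast
    have "ennreal (mean_avoid s - mean_avoid t) \<le> (\<integral>\<^sup>+\<omega>. (\<integral>\<^sup>+y. ennreal ((t - s) * (1 - \<phi> y) *
        avoid s (\<Xi> \<omega> - {y})) \<partial>count_space (\<Xi> \<omega>)) \<partial>M)"
      unfolding drop using avoid_diff_le st process_in_configs by (intro nn_integral_mono) auto
    also have "\<dots> = (\<integral>\<^sup>+y. ennreal ((t - s) * (1 - \<phi> y) * palm_avoid y s) \<partial>lborel)"
      using st s1 by (intro campbell)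
    also have "\<dots> \<le> (\<integral>\<^sup>+y. ennreal ((t - s) * c * (1 - \<phi> y)) \<partial>lborel)"
    proof (intro nn_integral_mono ennreal_leI)
      fix y
      have "(t - s) * (1 - \<phi> y) * palm_avoid y s \<le> (t - s) * (1 - \<phi> y) * c"
        using st c phi_le_1 by (intro mult_left_mono) auto
      then show "(t - s) * (1 - \<phi> y) * palm_avoid y s \<le> (t - s) * c * (1 - \<phi> y)"
        by (simp only: mult_ac)
    qed
    also have "\<dots> = ennreal ((t - s) * c * G)"
      using st c0 by (intro nn_integral_scaled_phi) auto
    finally show "mean_avoid s - mean_avoid t \<le> (t - s) * c * G"
      using st c0 G_nonneg by (subst (asm) ennreal_le_iff) auto }
  { assume c0: "0 \<le> c" and c: "\<And>x. c \<le> palm_avoid x t"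
    have "ennreal ((t - s) * c * G) = (\<integral>\<^sup>+y. ennreal ((t - s) * c * (1 - \<phi> y)) \<partial>lborel)"
      using st c0 by (intro nn_integral_scaled_phi[symmetric]) auto
    also have "\<dots> \<le> (\<integral>\<^sup>+y. ennreal ((t - s) * (1 - \<phi> y) * palm_avoid y t) \<partial>lborel)"
    proof (intro nn_integral_mono ennreal_leI)
      fix y
      have "(t - s) * (1 - \<phi> y) * c \<le> (t - s) * (1 - \<phi> y) * palm_avoid y t"
        using st c phi_le_1 by (intro mult_left_mono) auto
      then show "(t - s) * c * (1 - \<phi> y) \<le> (t - s) * (1 - \<phi> y) * palm_avoid y t"
        by (simp only: mult_ac)
    qed
    also have "\<dots> = (\<integral>\<^sup>+\<omega>. (\<integral>\<^sup>+y. ennreal ((t - s) * (1 - \<phi> y) *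
        avoid t (\<Xi> \<omega> - {y})) \<partial>count_space (\<Xi> \<omega>)) \<partial>M)"
      using st t0 by (intro campbell[symmetric])
    also have "\<dots> \<le> ennreal (mean_avoid s - mean_avoid t)"
      unfolding drop using avoid_diff_ge st process_in_configs by (intro nn_integral_mono) auto
    finally show "(t - s) * c * G \<le> mean_avoid s - mean_avoid t"
      using avoid_antimono st s1 t0 integrable_avoid process_in_configs
      by (subst (asm) ennreal_le_iff) (auto simp: mean_avoid_def intro!: integral_mono) }
qed

abbreviation lam :: real where "lam \<equiv> intensity M \<Xi> (pip_cond_intensity \<beta> \<phi>)"

lemma lam_nonneg: "0 \<le> lam"
  using palm_avoid_nonneg[of 0] by (simp add: palm_avoid_0)

lemma mean_avoid_0: "mean_avoid 0 = 1"
  by (simp add: mean_avoid_def avoid_0 prob_space)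

lemma mean_avoid_1: "\<beta> * mean_avoid 1 = lam"
proof -
  have "\<beta> * mean_avoid 1 = (\<integral>\<omega>. \<beta> * avoid 1 (\<Xi> \<omega>) \<partial>M)"
    by (simp add: mean_avoid_def)
  also have "\<dots> = palm_avoid 0 0"
    by (simp add: palm_avoid_def avoid_1 avoid_0)
  finally show ?thesis by (simp add: palm_avoid_0)
qed

text \<open>\<open>\<beta> * G < n\<close> keeps the ratio \<open>1 - \<beta> * G / n\<close> nonnegative, so that the decay over one step of length
  \<open>1 / n\<close> can be iterated.\<close>

lemma palm_avoid_grid:
  fixes k n :: nat
  assumes n: "\<beta> * G < real n" and "k \<le> n"
  shows "lam * (1 - \<beta> * G / n) ^ k \<le> palm_avoid x (k / n)"
  using \<open>k \<le> n\<close>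
proof (induction k)
  case 0
  then show ?case by (simp add: palm_avoid_0)
next
  case (Suc k)
  have n0: "0 < real n" using n beta_G_nonneg by linarith
  have "lam * (1 - \<beta> * G / n) ^ Suc k = (1 - \<beta> * G / n) * (lam * (1 - \<beta> * G / n) ^ k)"
    by simp
  also have "\<dots> \<le> (1 - \<beta> * G / n) * palm_avoid x (k / n)"
    using Suc n n0 by (intro mult_left_mono) auto
  also have "\<dots> = (1 - (Suc k / n - k / n) * (\<beta> * G)) * palm_avoid x (k / n)"
    using n0 by (simp add: field_simps)
  also have "\<dots> \<le> palm_avoid x (Suc k / n)"
    using Suc n0 by (intro palm_avoid_decay) (auto simp: divide_simps)
  finally show ?case .
qed

text \<open>The \<open>j\<close>-th step of the grid lowers \<open>\<beta> * mean_avoid\<close> by at least \<open>(\<beta> * G / n) * lam * q ^ j\<close>, where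
  \<open>\<beta> * G / n = 1 - q\<close>; the left-hand side is the sum of this geometric series.\<close>

lemma mean_avoid_grid:
  fixes k n :: nat
  assumes n: "\<beta> * G < real n" and "k \<le> n"
  defines "q \<equiv> 1 - \<beta> * G / n"
  shows "lam * q * (1 - q ^ k) \<le> \<beta> * (1 - mean_avoid (k / n))"
  using \<open>k \<le> n\<close>
proof (induction k)
  case 0
  then show ?case by (simp add: mean_avoid_0)
next
  case (Suc k)
  have n0: "0 < real n" using n beta_G_nonneg by linarith
  have q0: "0 \<le> q" using n n0 by (simp add: q_def)
  have "(Suc k / n - k / n) * (lam * q ^ Suc k) * G \<le> mean_avoid (k / n) - mean_avoid (Suc k / n)"
    using Suc n0 q0 lam_nonneg palm_avoid_grid[OF n Suc.prems] unfolding q_def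
    by (intro mean_avoid_diff(2)) (auto simp: divide_simps)
  then have "\<beta> * ((Suc k / n - k / n) * (lam * q ^ Suc k) * G) \<le>
      \<beta> * (mean_avoid (k / n) - mean_avoid (Suc k / n))"
    using beta_pos by (intro mult_left_mono) auto
  moreover have "\<beta> * ((Suc k / n - k / n) * (lam * q ^ Suc k) * G) = (1 - q) * (lam * q ^ Suc k)"
    using n0 by (simp add: q_def field_simps)
  moreover have "lam * q * (1 - q ^ Suc k) = lam * q * (1 - q ^ k) + (1 - q) * (lam * q ^ Suc k)"
    by (simp add: algebra_simps)
  moreover have "lam * q * (1 - q ^ k) \<le> \<beta> * (1 - mean_avoid (k / n))"
    using Suc by simp
  ultimately show ?case by (simp add: algebra_simps)
qed

text \<open>The grid estimate at \<open>k = n\<close>, with \<open>n \<rightarrow> \<infinity>\<close>.\<close>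

lemma intensity_upper: "lam * (2 - exp (- \<beta> * G)) \<le> \<beta>"
proof -
  let ?q = "\<lambda>n::nat. 1 + (- \<beta> * G) / n"
  have "(\<lambda>n. lam * ?q n * (1 - ?q n ^ n)) \<longlonglongrightarrow> lam * (1 + 0) * (1 - exp (- \<beta> * G))"
    by (intro tendsto_intros tendsto_exp_limit_sequentially lim_const_over_n)
  moreover have "\<forall>\<^sub>F n in sequentially. lam * ?q n * (1 - ?q n ^ n) \<le> \<beta> * (1 - mean_avoid 1)"
  proof -
    have "\<forall>\<^sub>F n in sequentially. \<beta> * G < real n"
      using filterlim_real_sequentially filterlim_at_top_dense by blast
    moreover have "\<forall>\<^sub>F n in sequentially. 0 < n" by (rule eventually_gt_at_top)
    ultimately show ?thesis
    proof eventually_elim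
      case (elim n)
      then show ?case using mean_avoid_grid[of n n] by simp
    qed
  qed
  ultimately have "lam * (1 + 0) * (1 - exp (- \<beta> * G)) \<le> \<beta> * (1 - mean_avoid 1)"
    by (intro tendsto_upperbound) auto
  then show ?thesis using mean_avoid_1 by (simp add: algebra_simps)
qed

text \<open>A single step from \<open>0\<close> to \<open>1\<close> is enough here.\<close>

lemma intensity_lower: "\<beta> \<le> lam * (1 + \<beta> * G)"
proof -
  have "1 - mean_avoid 1 \<le> lam * G"
    using mean_avoid_diff(1)[of 0 1 lam] by (simp add: palm_avoid_0 mean_avoid_0)
  then have "\<beta> * (1 - mean_avoid 1) \<le> \<beta> * (lam * G)"
    using beta_pos by (intro mult_left_mono) auto
  then show ?thesis using mean_avoid_1 by (simp add: algebra_simps)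
qed

end

section \<open>The intensity bounds\<close>

theorem theorem3p1:
  fixes M :: "'w measure" and \<Xi> :: "'w \<Rightarrow> (real ^ 'd) set"
    and \<beta> G lam :: real and \<phi> :: "real ^ 'd \<Rightarrow> real"
  assumes "PIP M \<Xi> \<beta> \<phi>" and "inhibitory \<phi>" and "finite_range \<phi>"
    and "lam = intensity M \<Xi> (pip_cond_intensity \<beta> \<phi>)"
    and "G = (\<integral>x. (1 - \<phi> x) \<partial>lborel)"
  shows "\<beta> / (1 + \<beta> * G) \<le> lam \<and> lam \<le> \<beta> / (2 - exp (- \<beta> * G))"
proof -
  interpret P: inhibitory_PIP M \<Xi> \<beta> \<phi>
    using assms by unfold_locales
  have G: "P.G = G" using assms(5) by (simp add: P.G_def)
  have "0 \<le> \<beta> * G" using P.beta_G_nonneg by (simp add: G)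
  then have pos: "0 < 1 + \<beta> * G" "0 < 2 - exp (- \<beta> * G)"
    by (auto intro: le_less_trans[of _ 1])
  show ?thesis
    using P.intensity_lower P.intensity_upper pos by (simp add: G assms(4) field_simps)
qed

end
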